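(* Let $L$ be a bounded distributive lattice with bottom element $0$ and top element $1$, let $n\geqslant 1$, and let $f\colon L^n\to L$ be an order-preserving function. The following conditions are equivalent: (i) $f$ is a polynomial function; (ii) for every $\mathbf{x}\in L^n$ and every $k\in[n]$, $f(\mathbf{x})=\operatorname{med}\big(f(\mathbf{x}_k^0),\,x_k,\,f(\mathbf{x}_k^1)\big)$; (iii) all of the following hold: $f(\mathbf{x}_k^{a\wedge b})=f(\mathbf{x}_k^a)\wedge f(\mathbf{x}_k^b)$ and $f(\mathbf{x}_k^{a\vee b})=f(\mathbf{x}_k^a)\vee f(\mathbf{x}_k^b)$ for all $\mathbf{x}\in L^n$, $a,b\in L$, $k\in[n]$; the set $\mathcal{R}(f)$ is convex, and the set $\mathcal{R}(f_{-k}^{\mathbf{a}})$ is convex for every $\mathbf{a}\in L^n$ and $k\in[n]$; and $f(\mathbf{x}_k^{f(\mathbf{x})})=f(\mathbf{x})$ for every $\mathbf{x}\in L^n$ and $k\in[n]$; (iv) for all $\mathbf{x}\in L^n$ and all $c\in[f(\overline{0}),f(\overline{1})]$, $f(\mathbf{x}\wedge\overline{c})=f(\mathbf{x})\wedge c$ and $f(\mathbf{x}\vee\overline{c})=f(\mathbf{x})\vee c$; (v) all of the following hold: $f(\mathbf{x}_k^{a\vee b})=f(\mathbf{x}_k^a)\vee f(\mathbf{x}_k^b)$ for all $\mathbf{x}\in L^n$, $a,b\in L$, $k\in[n]$; and, for all $\mathbf{x}\in L^n$ and all $c\in[f(\overline{0}),f(\overline{1})]$, $f(\mathbf{x}\wedge\overline{c})=f(\mathbf{x})\wedge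 c$ and $f(\mathbf{x})=f(\mathbf{x}\wedge\overline{c})\vee f([\mathbf{x}]_c)$; (vi) all of the following hold: $f(\mathbf{x}_k^{a\wedge b})=f(\mathbf{x}_k^a)\wedge f(\mathbf{x}_k^b)$ and $f(\mathbf{x}_k^{a\vee b})=f(\mathbf{x}_k^a)\vee f(\mathbf{x}_k^b)$ for all $\mathbf{x}\in L^n$, $a,b\in L$, $k\in[n]$; for all $\mathbf{x}\in L^n$ and all $c\in[f(\overline{0}),f(\overline{1})]$, $f(\mathbf{x})=f(\mathbf{x}\wedge\overline{c})\vee f([\mathbf{x}]_c)$ and $f(\mathbf{x})=f(\mathbf{x}\vee\overline{c})\wedge f([\mathbf{x}]^c)$; and $f(\overline{c})=c$ for all $c\in[f(\overline{0}),f(\overline{1})]$.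
   Context: A polynomial function $f\colon L^n\to L$ is a map that can be obtained by composition of the binary operations $\wedge$ and $\vee$, the projections, and the constant functions. Write $[n]=\{1,\ldots,n\}$. The order and the operations $\wedge,\vee$ on $L^n$ are componentwise. For $a\leqslant b$ in $L$, $[a,b]=\{x\in L: a\leqslant x\leqslant b\}$. A subset $S\subseteq L$ is convex if $a,b\in S$ and $a\leqslant x\leqslant b$ imply $x\in S$. The median is $\operatorname{med}(x,y,z)=(x\vee y)\wedge(x\vee z)\wedge(y\vee z)$. For $c\in L$, $\overline{c}=(c,\ldots,c)\in L^n$. For $\mathbf{x}=(x_1,\ldots,x_n)\in L^n$, $k\in[n]$, $a\in L$, the tuple $\mathbf{x}_k^a\in L^n$ has $i$th component $a$ if $i=k$ and $x_i$ otherwise. For $c\in L$, $[\mathbf{x}]_c\in L^n$ is the tuple whose $i$th component is $0$ if $x_i\leqslant c$ and $x_i$ otherwise; $[\mathbf{x}]^c\in L^n$ is the tuple whose $i$th component is $1$ if $x_i\geqslant c$ and $x_i$ otherwise. The range of a function $g\colon L^m\to L$ is $\mathcal{R}(g)=\{g(\mathbf{x}):\mathbf{x}\in L^m\}$. For $k\in[n]$ and $\mathbf{a}\in L^n$, the unary function $f_{-k}^{\mathbf{a}}\colon L\to L$ is $f_{-k}^{\mathbf{a}}(x)=f(\mathbf{a}_k^x)$. *)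

theory Defs imports Main begin

unbundle lattice_syntax

(* A bounded distributive lattice is a type of sort {distrib_lattice, bounded_lattice}, in which
   bottom and top are not required to differ.  L^n is the function type 'n => 'a over a finite
   index type 'n, which is nonempty; order, meet and join on it are the pointwise library ones.
   The tuple x_k^a is x(k := a), and the constant tuple (c, ..., c) is (\<lambda>_. c). *)

inductive lattice_polynomial ::
  "(('n::finite \<Rightarrow> 'a::{distrib_lattice, bounded_lattice}) \<Rightarrow> 'a) \<Rightarrow> bool"
where
  proj: "lattice_polynomial (\<lambda>x. x k)"
| const: "lattice_polynomial (\<lambda>_. c)"
| inf: "lattice_polynomial p \<Longrightarrow> lattice_polynomial q \<Longrightarrow> lattice_polynomial (\<lambda>x. p x \<sqinter> q x)"
| sup: "lattice_polynomial p \<Longrightarrow> lattice_polynomial q \<Longrightarrow> lattice_polynomial (\<lambda>x. p x \<squnion> q x)"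

definition med :: "'a::lattice \<Rightarrow> 'a \<Rightarrow> 'a \<Rightarrow> 'a" where
  "med x y z = (x \<squnion> y) \<sqinter> (x \<squnion> z) \<sqinter> (y \<squnion> z)"

definition order_convex :: "'a::order set \<Rightarrow> bool" where
  "order_convex S \<longleftrightarrow> (\<forall>a\<in>S. \<forall>b\<in>S. \<forall>x. a \<le> x \<and> x \<le> b \<longrightarrow> x \<in> S)"

(* The tuples written [x]_c and [x]^c.  The order is partial, so "otherwise" also covers
   components incomparable to c. *)

definition lower_trunc :: "'a \<Rightarrow> ('n \<Rightarrow> 'a) \<Rightarrow> 'n \<Rightarrow> 'a::bounded_lattice" where
  "lower_trunc c x = (\<lambda>i. if x i \<le> c then \<bottom> else x i)"

definition upper_trunc :: "'a \<Rightarrow> ('n \<Rightarrow> 'a) \<Rightarrow> 'n \<Rightarrow> 'a::bounded_lattice" where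
  "upper_trunc c x = (\<lambda>i. if x i \<ge> c then \<top> else x i)"

end

theory Submission imports Defs begin

text \<open>
  Conditions (i)--(iii) all say that every section \<open>g t = f (x(k := t))\<close> is the median function
  \<open>t \<mapsto> med (g \<bottom>) t (g \<top>)\<close>: expanding one variable after the other then yields a polynomial, and
  a lattice endomorphism \<open>g\<close> with convex range and \<open>g \<circ> g = g\<close> fixes
  \<open>u = g \<bottom> \<squnion> (t \<sqinter> g \<top>)\<close>, whence \<open>u = g u = g t\<close>.  Under (iv), put \<open>c = f \<bottom> \<squnion> (x k \<sqinter> f \<top>)\<close>.
  Then \<open>x(k := \<top>) \<sqinter> c \<le> x \<squnion> f \<bottom>\<close> and \<open>x \<sqinter> f \<top> \<le> x(k := \<bottom>) \<squnion> c\<close>; applying \<open>f\<close>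
  encloses \<open>f x\<close> between the disjunctive and the conjunctive form of the median, which agree.
  For (v) and (vi), joining in one variable at a time reduces \<open>f (x \<squnion> c) \<le> f x \<squnion> c\<close> to the tuples
  \<open>z\<close> with every \<open>z i \<in> {x i, c}\<close>; for these the truncation of \<open>z\<close> at \<open>c\<close> lies below \<open>x\<close>.
\<close>

section \<open>The median between comparable bounds; monotonicity\<close>

lemma med_eq_inf_sup:
  fixes p q t :: "'a::distrib_lattice"
  assumes "p \<le> q"
  shows "med p t q = (p \<squnion> t) \<sqinter> q"
  using assms by (simp add: med_def sup.absorb2 inf.assoc inf.absorb1)

lemma med_eq_sup_inf:
  fixes p q t :: "'a::distrib_lattice"
  assumes "p \<le> q"
  shows "med p t q = p \<squnion> (t \<sqinter> q)"
  using assms by (simp add: med_eq_inf_sup sup_inf_distrib1 sup.absorb2)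

lemma fun_upd_mono:
  fixes x :: "'n \<Rightarrow> 'a::order"
  assumes "a \<le> b"
  shows "x(k := a) \<le> x(k := b)"
  using assms by (simp add: le_fun_def)

lemma section_bounds:
  fixes f :: "('n \<Rightarrow> 'a::bounded_lattice) \<Rightarrow> 'a"
  assumes "mono f"
  shows "f (x(k := \<bottom>)) \<le> f (x(k := t))" "f (x(k := t)) \<le> f (x(k := \<top>))"
  using assms by (simp_all add: monoD fun_upd_mono)

lemma const_bounds:
  fixes f :: "('n \<Rightarrow> 'a::bounded_lattice) \<Rightarrow> 'a"
  assumes "mono f"
  shows "f (\<lambda>_. \<bottom>) \<le> f x" "f x \<le> f (\<lambda>_. \<top>)"
  using assms by (simp_all add: monoD le_fun_def)

section \<open>Polynomial functions as iterated medians in single variables\<close>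

lemma lattice_polynomial_mono:
  assumes "lattice_polynomial p"
  shows "mono p"
  using assms
proof induction
  case (inf p q)
  then show ?case by (auto simp: mono_def intro: le_infI1 le_infI2)
next
  case (sup p q)
  then show ?case by (auto simp: mono_def intro: le_supI1 le_supI2)
qed (auto intro!: monoI dest: le_funD)

text \<open>Induction over the construction. Meets of medians are computed in the form
  \<open>(p \<squnion> t) \<sqinter> q\<close> and joins in the form
  \<open>p \<squnion> (t \<sqinter> q)\<close>, where a single distributive law suffices;
  monotonicity makes both forms available.\<close>

lemma lattice_polynomial_section:
  assumes "lattice_polynomial p"
  shows "p x = med (p (x(k := \<bottom>))) (x k) (p (x(k := \<top>)))"
  using assms
proof induction
  case (proj j)
  then show ?case by (simp add: med_def inf.absorb1 inf.absorb2)
next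
  case (const c)
  then show ?case by (simp add: med_def inf.absorb1 inf.absorb2)
next
  case (inf p q)
  have p: "p (x(k := \<bottom>)) \<le> p (x(k := \<top>))" and q: "q (x(k := \<bottom>)) \<le> q (x(k := \<top>))"
    by (rule section_bounds(1)[OF lattice_polynomial_mono[OF inf.hyps(1)]],
        rule section_bounds(1)[OF lattice_polynomial_mono[OF inf.hyps(2)]])
  show ?case
    unfolding inf.IH(1) inf.IH(2) med_eq_inf_sup[OF p] med_eq_inf_sup[OF q]
      med_eq_inf_sup[OF inf_mono[OF p q]]
    by (simp add: sup_inf_distrib2 inf.commute inf.left_commute inf.assoc)
next
  case (sup p q)
  have p: "p (x(k := \<bottom>)) \<le> p (x(k := \<top>))" and q: "q (x(k := \<bottom>)) \<le> q (x(k := \<top>))"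
    by (rule section_bounds(1)[OF lattice_polynomial_mono[OF sup.hyps(1)]],
        rule section_bounds(1)[OF lattice_polynomial_mono[OF sup.hyps(2)]])
  show ?case
    unfolding sup.IH(1) sup.IH(2) med_eq_sup_inf[OF p] med_eq_sup_inf[OF q]
      med_eq_sup_inf[OF sup_mono[OF p q]]
    by (simp add: inf_sup_distrib1 sup.commute sup.left_commute sup.assoc)
qed

lemma lattice_polynomial_med:
  assumes "lattice_polynomial p" "lattice_polynomial q" "lattice_polynomial r"
  shows "lattice_polynomial (\<lambda>x. med (p x) (q x) (r x))"
  unfolding med_def by (intro lattice_polynomial.inf lattice_polynomial.sup assms)

lemma lattice_polynomial_if_section_med:
  fixes f :: "('n::finite \<Rightarrow> 'a::{distrib_lattice, bounded_lattice}) \<Rightarrow> 'a"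
  assumes med: "\<And>x k. f x = med (f (x(k := \<bottom>))) (x k) (f (x(k := \<top>)))"
  shows "lattice_polynomial f"
proof -
  \<comment> \<open>Only the coordinates in \<open>S\<close> vary, the others are frozen at
    \<open>a\<close>. Adding \<open>k\<close> to \<open>S\<close> takes the median at
    \<open>k\<close> of the two functions with \<open>a k\<close> replaced by \<bottom> and \<top>;
    \<open>S = UNIV\<close> gives \<open>f\<close>.\<close>
  have "lattice_polynomial (\<lambda>x. f (override_on a x S))" if "finite S" for S a
    using that
  proof (induction S arbitrary: a)
    case empty
    then show ?case by (simp add: lattice_polynomial.const)
  next
    case (insert k S)
    have upd: "(override_on a x (insert k S))(k := b) = override_on (a(k := b)) x S" for x b
      using insert.hyps by (auto simp: override_on_def)
    have "f (override_on a x (insert k S)) =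
        med (f (override_on (a(k := \<bottom>)) x S)) (x k) (f (override_on (a(k := \<top>)) x S))" for x
      using med[of "override_on a x (insert k S)" k] unfolding upd by simp
    then show ?case
      by (simp add: lattice_polynomial_med insert.IH lattice_polynomial.proj)
  qed
  from this[OF finite_UNIV] show ?thesis
    by (simp add: override_on_def)
qed

section \<open>Homogeneity of polynomial functions\<close>

text \<open>By distributivity, having the same meet with \<open>c\<close> is a lattice congruence,
  and polynomial functions respect congruences; \<open>x\<close> and
  \<open>x \<sqinter> (\<lambda>_. c)\<close> are congruent in every component. Dually for
  joins.\<close>

lemma lattice_polynomial_const_tuple:
  fixes f :: "('n::finite \<Rightarrow> 'a::{distrib_lattice, bounded_lattice}) \<Rightarrow> 'a"
  assumes "lattice_polynomial f"
  shows "f (x \<sqinter> (\<lambda>_. c)) \<sqinter> c = f x \<sqinter> c" and "f (x \<squnion> (\<lambda>_. c)) \<squnion> c = f x \<squnion> c"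
proof -
  have "f (x \<sqinter> (\<lambda>_. c)) \<sqinter> c = f x \<sqinter> c \<and> f (x \<squnion> (\<lambda>_. c)) \<squnion> c = f x \<squnion> c"
    using assms
  proof induction
    case (inf p q)
    have "p (x \<sqinter> (\<lambda>_. c)) \<sqinter> c \<sqinter> (q (x \<sqinter> (\<lambda>_. c)) \<sqinter> c) = p x \<sqinter> c \<sqinter> (q x \<sqinter> c)"
      by (simp only: inf.IH)
    moreover have "a \<sqinter> b \<sqinter> c = a \<sqinter> c \<sqinter> (b \<sqinter> c)" for a b
      by (simp add: ac_simps)
    ultimately show ?case
      using inf.IH by (simp add: sup_inf_distrib2)
  next
    case (sup p q)
    have "p (x \<squnion> (\<lambda>_. c)) \<squnion> c \<squnion> (q (x \<squnion> (\<lambda>_. c)) \<squnion> c) = p x \<squnion> c \<squnion> (q x \<squnion> c)"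
      by (simp only: sup.IH)
    moreover have "a \<squnion> b \<squnion> c = a \<squnion> c \<squnion> (b \<squnion> c)" for a b
      by (simp add: ac_simps)
    ultimately show ?case
      using sup.IH by (simp add: inf_sup_distrib2)
  qed (simp_all add: inf.assoc sup.assoc)
  then show "f (x \<sqinter> (\<lambda>_. c)) \<sqinter> c = f x \<sqinter> c" "f (x \<squnion> (\<lambda>_. c)) \<squnion> c = f x \<squnion> c"
    by auto
qed

text \<open>The constant tuple of \<open>c\<close> arises from the bottom tuple by joining with
  \<open>c\<close> and from the top tuple by meeting with \<open>c\<close>, so the two congruences
  compare its value with the bounds of \<open>c\<close>.\<close>

lemma lattice_polynomial_idem:
  fixes f :: "('n::finite \<Rightarrow> 'a::{distrib_lattice, bounded_lattice}) \<Rightarrow> 'a"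
  assumes "lattice_polynomial f" and "f (\<lambda>_. \<bottom>) \<le> c" "c \<le> f (\<lambda>_. \<top>)"
  shows "f (\<lambda>_. c) = c"
proof (rule antisym)
  have "f (\<lambda>_. c) \<squnion> c = f (\<lambda>_. \<bottom>) \<squnion> c"
    using lattice_polynomial_const_tuple(2)[OF assms(1), of "\<lambda>_. \<bottom>" c] by (simp add: sup_fun_def)
  then show "f (\<lambda>_. c) \<le> c"
    using assms(2) by (simp add: sup.absorb2 le_iff_sup)
  have "f (\<lambda>_. c) \<sqinter> c = f (\<lambda>_. \<top>) \<sqinter> c"
    using lattice_polynomial_const_tuple(1)[OF assms(1), of "\<lambda>_. \<top>" c] by (simp add: inf_fun_def)
  then show "c \<le> f (\<lambda>_. c)"
    using assms(3) by (metis inf.absorb_iff2)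
qed

lemma lattice_polynomial_homogeneous:
  fixes f :: "('n::finite \<Rightarrow> 'a::{distrib_lattice, bounded_lattice}) \<Rightarrow> 'a"
  assumes p: "lattice_polynomial f" and c: "f (\<lambda>_. \<bottom>) \<le> c" "c \<le> f (\<lambda>_. \<top>)"
  shows "f (x \<sqinter> (\<lambda>_. c)) = f x \<sqinter> c" and "f (x \<squnion> (\<lambda>_. c)) = f x \<squnion> c"
proof -
  note mono = monoD[OF lattice_polynomial_mono[OF p]]
  have "f (x \<sqinter> (\<lambda>_. c)) \<le> c"
    using mono[of "x \<sqinter> (\<lambda>_. c)" "\<lambda>_. c"] lattice_polynomial_idem[OF p c] by simp
  then show "f (x \<sqinter> (\<lambda>_. c)) = f x \<sqinter> c"
    using lattice_polynomial_const_tuple(1)[OF p, of x c] by (simp add: inf.absorb1)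
  have "c \<le> f (x \<squnion> (\<lambda>_. c))"
    using mono[of "\<lambda>_. c" "x \<squnion> (\<lambda>_. c)"] lattice_polynomial_idem[OF p c] by simp
  then show "f (x \<squnion> (\<lambda>_. c)) = f x \<squnion> c"
    using lattice_polynomial_const_tuple(2)[OF p, of x c] by (simp add: sup.absorb1)
qed

section \<open>Decomposition by truncated tuples\<close>

lemma lower_trunc_le: "lower_trunc c x \<le> x"
  by (simp add: lower_trunc_def le_fun_def)

lemma le_upper_trunc: "x \<le> upper_trunc c x"
  by (simp add: upper_trunc_def le_fun_def)

lemma le_sup_lower_trunc: "x \<le> lower_trunc c x \<squnion> (\<lambda>_. c)"
  by (simp add: lower_trunc_def le_fun_def)

lemma inf_upper_trunc_le: "upper_trunc c x \<sqinter> (\<lambda>_. c) \<le> x"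
  by (simp add: upper_trunc_def le_fun_def)

text \<open>From \<open>x \<le> lower_trunc c x \<squnion> (\<lambda>_. c)\<close>, homogeneity
  gives \<open>f x \<le> f (lower_trunc c x) \<squnion> c\<close>. Meeting the right side with
  \<open>f x\<close> and distributing produces the two parts.\<close>

lemma homogeneous_lower_trunc:
  fixes f :: "('n \<Rightarrow> 'a::{distrib_lattice, bounded_lattice}) \<Rightarrow> 'a"
  assumes "mono f"
    and inf: "f (x \<sqinter> (\<lambda>_. c)) = f x \<sqinter> c"
    and sup: "f (lower_trunc c x \<squnion> (\<lambda>_. c)) = f (lower_trunc c x) \<squnion> c"
  shows "f x = f (x \<sqinter> (\<lambda>_. c)) \<squnion> f (lower_trunc c x)"
proof -
  have "f x \<le> f (lower_trunc c x) \<squnion> c"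
    using monoD[OF \<open>mono f\<close> le_sup_lower_trunc[of x c]] sup by simp
  then have "f x = f x \<sqinter> (f (lower_trunc c x) \<squnion> c)"
    by (simp add: inf.absorb1)
  also have "\<dots> = f (lower_trunc c x) \<squnion> f (x \<sqinter> (\<lambda>_. c))"
    using monoD[OF \<open>mono f\<close> lower_trunc_le[of c x]] by (simp add: inf_sup_distrib1 inf.absorb2 inf)
  finally show ?thesis
    by (simp add: sup.commute)
qed

text \<open>Order dual, starting from
  \<open>upper_trunc c x \<sqinter> (\<lambda>_. c) \<le> x\<close>.\<close>

lemma homogeneous_upper_trunc:
  fixes f :: "('n \<Rightarrow> 'a::{distrib_lattice, bounded_lattice}) \<Rightarrow> 'a"
  assumes "mono f"
    and sup: "f (x \<squnion> (\<lambda>_. c)) = f x \<squnion> c"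
    and inf: "f (upper_trunc c x \<sqinter> (\<lambda>_. c)) = f (upper_trunc c x) \<sqinter> c"
  shows "f x = f (x \<squnion> (\<lambda>_. c)) \<sqinter> f (upper_trunc c x)"
proof -
  have "f (upper_trunc c x) \<sqinter> c \<le> f x"
    using monoD[OF \<open>mono f\<close> inf_upper_trunc_le[of c x]] inf by simp
  then have "f x = f x \<squnion> (f (upper_trunc c x) \<sqinter> c)"
    by (simp add: sup.absorb1)
  also have "\<dots> = f (upper_trunc c x) \<sqinter> f (x \<squnion> (\<lambda>_. c))"
    using monoD[OF \<open>mono f\<close> le_upper_trunc[of x c]] by (simp add: sup_inf_distrib1 sup.absorb2 sup)
  finally show ?thesis
    by (simp add: inf.commute)
qed

section \<open>Sections as lattice homomorphisms with convex range\<close>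

lemma section_inf_sup_hom:
  fixes f :: "('n \<Rightarrow> 'a::{distrib_lattice, bounded_lattice}) \<Rightarrow> 'a"
  assumes "mono f" and med: "\<And>x. f x = med (f (x(k := \<bottom>))) (x k) (f (x(k := \<top>)))"
  shows "f (x(k := a \<sqinter> b)) = f (x(k := a)) \<sqinter> f (x(k := b))"
    and "f (x(k := a \<squnion> b)) = f (x(k := a)) \<squnion> f (x(k := b))"
proof -
  have le: "f (x(k := \<bottom>)) \<le> f (x(k := \<top>))"
    using \<open>mono f\<close> by (simp add: monoD fun_upd_mono)
  have med: "f (x(k := t)) = med (f (x(k := \<bottom>))) t (f (x(k := \<top>)))" for t
    using med[of "x(k := t)"] by simp
  show "f (x(k := a \<sqinter> b)) = f (x(k := a)) \<sqinter> f (x(k := b))"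
    unfolding med[of a] med[of b] med[of "a \<sqinter> b"] med_eq_inf_sup[OF le]
    by (simp add: sup_inf_distrib1 inf.left_commute inf.assoc)
  show "f (x(k := a \<squnion> b)) = f (x(k := a)) \<squnion> f (x(k := b))"
    unfolding med[of a] med[of b] med[of "a \<squnion> b"] med_eq_sup_inf[OF le]
    by (simp add: inf_sup_distrib2 sup.left_commute sup.assoc)
qed

text \<open>The median clamps its middle argument to an interval and so fixes every \<open>y\<close>
  in it. This yields both the convexity of the range of a section and
  \<open>f (x(k := f x)) = f x\<close>.\<close>

lemma section_range_eq:
  fixes f :: "('n \<Rightarrow> 'a::{distrib_lattice, bounded_lattice}) \<Rightarrow> 'a"
  assumes med: "\<And>x. f x = med (f (x(k := \<bottom>))) (x k) (f (x(k := \<top>)))"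
    and y: "f (x(k := \<bottom>)) \<le> y" "y \<le> f (x(k := \<top>))"
  shows "f (x(k := y)) = y"
  using med[of "x(k := y)"] order_trans[OF y] y
  by (simp add: med_eq_sup_inf inf.absorb1 sup.absorb2)

lemma section_med_if_hom_convex:
  fixes f :: "('n \<Rightarrow> 'a::{distrib_lattice, bounded_lattice}) \<Rightarrow> 'a"
  assumes "mono f"
    and inf: "\<And>a b. f (x(k := a \<sqinter> b)) = f (x(k := a)) \<sqinter> f (x(k := b))"
    and sup: "\<And>a b. f (x(k := a \<squnion> b)) = f (x(k := a)) \<squnion> f (x(k := b))"
    and convex: "order_convex (range (\<lambda>t. f (x(k := t))))"
    and idem: "\<And>x. f (x(k := f x)) = f x"
  shows "f x = med (f (x(k := \<bottom>))) (x k) (f (x(k := \<top>)))"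
proof -
  define g where "g t = f (x(k := t))" for t
  have gg: "g (g t) = g t" for t
    using idem[of "x(k := t)"] by (simp add: g_def)
  have le: "g \<bottom> \<le> g t" "g t \<le> g \<top>" for t
    using section_bounds[OF \<open>mono f\<close>] by (simp_all add: g_def)
  \<comment> \<open>The intended median in disjunctive form. It lies between two values of
    \<open>g\<close>, so convexity makes it a value of \<open>g\<close> and idempotence a fixed
    point.\<close>
  define u where "u = g \<bottom> \<squnion> (x k \<sqinter> g \<top>)"
  have "g \<bottom> \<le> u" "u \<le> g \<top>"
    using le by (simp_all add: u_def)
  then have "u \<in> range g"
    using convex unfolding order_convex_def g_def[symmetric] by blast
  then have "u = g u"
    using gg by auto
  \<comment> \<open>The bounds \<open>g \<bottom>\<close> and \<open>g \<top>\<close> are fixed by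
    \<open>g\<close>, while \<open>x k\<close> becomes \<open>g (x k)\<close>, which already lies
    between them.\<close>
  also have "\<dots> = g (g \<bottom>) \<squnion> (g (x k) \<sqinter> g (g \<top>))"
    by (simp add: u_def g_def inf sup)
  also have "\<dots> = g (x k)"
    using le by (simp add: gg inf.absorb1 sup.absorb2)
  finally have "f x = g \<bottom> \<squnion> (x k \<sqinter> g \<top>)"
    by (simp add: u_def g_def)
  then show ?thesis
    using le(1)[of \<top>] by (simp add: med_eq_sup_inf g_def)
qed

section \<open>From homogeneity to the median condition\<close>

lemma section_med_if_homogeneous:
  fixes f :: "('n \<Rightarrow> 'a::{distrib_lattice, bounded_lattice}) \<Rightarrow> 'a"
  assumes "mono f"
    and inf: "\<And>x c. f (\<lambda>_. \<bottom>) \<le> c \<Longrightarrow> c \<le> f (\<lambda>_. \<top>) \<Longrightarrow> f (x \<sqinter> (\<lambda>_. c)) = f x \<sqinter> c"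
    and sup: "\<And>x c. f (\<lambda>_. \<bottom>) \<le> c \<Longrightarrow> c \<le> f (\<lambda>_. \<top>) \<Longrightarrow> f (x \<squnion> (\<lambda>_. c)) = f x \<squnion> c"
  shows "f x = med (f (x(k := \<bottom>))) (x k) (f (x(k := \<top>)))"
proof -
  let ?o = "f (\<lambda>_. \<bottom>)" and ?i = "f (\<lambda>_. \<top>)"
  let ?p = "f (x(k := \<bottom>))" and ?q = "f (x(k := \<top>))"
  \<comment> \<open>\<open>x k\<close> clamped to the interval on which homogeneity is
    assumed.\<close>
  define c where "c = ?o \<squnion> (x k \<sqinter> ?i)"
  note bounds = const_bounds[OF \<open>mono f\<close>]
  have c: "?o \<le> c" "c \<le> ?i"
    using bounds by (simp_all add: c_def)
  have pq: "?p \<le> f x" "f x \<le> ?q"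
    using section_bounds[OF \<open>mono f\<close>, of x k "x k"] by simp_all
  have "?q \<sqinter> c = f (x(k := \<top>) \<sqinter> (\<lambda>_. c))"
    using inf[OF c] by simp
  \<comment> \<open>Componentwise: \<open>c \<le> x k \<squnion> ?o\<close> at \<open>k\<close>, and
    \<open>x i \<sqinter> c \<le> x i\<close> elsewhere.\<close>
  also have "\<dots> \<le> f (x \<squnion> (\<lambda>_. ?o))"
    by (rule monoD[OF \<open>mono f\<close>]) (auto simp: le_fun_def c_def intro: le_infI1 le_supI1)
  also have "\<dots> = f x"
    using sup[of ?o x] bounds by (simp add: sup.absorb1)
  finally have lower: "?q \<sqinter> c \<le> f x" .
  have "f x = f (x \<sqinter> (\<lambda>_. ?i))"
    using inf[of ?i x] bounds by (simp add: inf.absorb1)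
  also have "\<dots> \<le> f (x(k := \<bottom>) \<squnion> (\<lambda>_. c))"
    by (rule monoD[OF \<open>mono f\<close>]) (auto simp: le_fun_def c_def intro: le_infI1 le_supI1)
  also have "\<dots> = ?p \<squnion> c"
    using sup[OF c] by simp
  finally have upper: "f x \<le> ?p \<squnion> c" .
  \<comment> \<open>The clamping is removed: since \<open>?q \<le> ?i\<close> and
    \<open>?o \<le> ?p\<close>, both estimates survive with \<open>x k\<close> in place of
    \<open>c\<close>.\<close>
  have "x k \<sqinter> ?q \<le> c"
    unfolding c_def by (intro le_supI2 inf_mono order_refl bounds)
  then have "x k \<sqinter> ?q \<le> ?q \<sqinter> c"
    by simp
  then have "?p \<squnion> (x k \<sqinter> ?q) \<le> f x"
    using lower pq by (meson le_sup_iff order_trans)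
  moreover have "?p \<squnion> c \<le> ?p \<squnion> x k"
    using bounds(1)[of "x(k := \<bottom>)"] by (auto simp: c_def intro: le_supI1 le_supI2 le_infI1)
  then have "f x \<le> (?p \<squnion> x k) \<sqinter> ?q"
    using upper pq by (meson le_inf_iff order_trans)
  ultimately show ?thesis
    using med_eq_sup_inf[OF order_trans[OF pq], of "x k"] med_eq_inf_sup[OF order_trans[OF pq], of "x k"]
    by (metis antisym)
qed

section \<open>Expansion over mixed tuples, and homogeneity from truncation\<close>

text \<open>Expanding coordinate by coordinate, \<open>f (x \<squnion> y)\<close> is the join of the
  values \<open>f z\<close> over all \<open>z\<close> choosing \<open>x i\<close> or
  \<open>y i\<close> at each \<open>i\<close>. The common bound \<open>u\<close> avoids writing this
  finite join.\<close>

lemma section_sup_hom_le: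
  fixes f :: "('n::finite \<Rightarrow> 'a::lattice) \<Rightarrow> 'b::lattice"
  assumes sup: "\<And>x k a b. f (x(k := a \<squnion> b)) = f (x(k := a)) \<squnion> f (x(k := b))"
    and le: "\<And>z. (\<And>i. z i = x i \<or> z i = y i) \<Longrightarrow> f z \<le> u"
  shows "f (x \<squnion> y) \<le> u"
proof -
  \<comment> \<open>\<open>T\<close> contains the coordinates where \<open>z\<close> may still carry
    the join. Splitting the join at \<open>k\<close> leaves two tuples covered by the smaller
    set.\<close>
  have "f z \<le> u" if "finite T" "\<And>i. z i = x i \<or> z i = y i \<or> i \<in> T \<and> z i = x i \<squnion> y i" for T z
    using that
  proof (induction T arbitrary: z)
    case empty
    then show ?case by (auto intro: le)
  next
    case (insert k T)
    show ?case
    proof (cases "z k = x k \<squnion> y k")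
      case True
      have "f (z(k := x k)) \<le> u" "f (z(k := y k)) \<le> u"
        using insert.prems by (intro insert.IH; metis fun_upd_apply insertE)+
      then show ?thesis
        using sup[of z k "x k" "y k"] True by (metis fun_upd_triv le_sup_iff)
    next
      case False
      then show ?thesis
        using insert.prems by (intro insert.IH) (metis insertE)
    qed
  qed
  from this[OF finite_UNIV, of "x \<squnion> y"] show ?thesis
    by simp
qed

text \<open>Order dual of the expansion over mixed tuples for joins.\<close>

lemma section_inf_hom_ge:
  fixes f :: "('n::finite \<Rightarrow> 'a::lattice) \<Rightarrow> 'b::lattice"
  assumes inf: "\<And>x k a b. f (x(k := a \<sqinter> b)) = f (x(k := a)) \<sqinter> f (x(k := b))"
    and ge: "\<And>z. (\<And>i. z i = x i \<or> z i = y i) \<Longrightarrow> u \<le> f z"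
  shows "u \<le> f (x \<sqinter> y)"
proof -
  have "u \<le> f z" if "finite T" "\<And>i. z i = x i \<or> z i = y i \<or> i \<in> T \<and> z i = x i \<sqinter> y i" for T z
    using that
  proof (induction T arbitrary: z)
    case empty
    then show ?case by (auto intro: ge)
  next
    case (insert k T)
    show ?case
    proof (cases "z k = x k \<sqinter> y k")
      case True
      have "u \<le> f (z(k := x k))" "u \<le> f (z(k := y k))"
        using insert.prems by (intro insert.IH; metis fun_upd_apply insertE)+
      then show ?thesis
        using inf[of z k "x k" "y k"] True by (metis fun_upd_triv le_inf_iff)
    next
      case False
      then show ?thesis
        using insert.prems by (intro insert.IH) (metis insertE)
    qed
  qed
  from this[OF finite_UNIV, of "x \<sqinter> y"] show ?thesis
    by simp
qed

text \<open>For the nontrivial inequality it suffices to bound \<open>f z\<close> when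
  \<open>z\<close> mixes \<open>x\<close> with the constant \<open>c\<close>. Of the two parts of
  \<open>f z\<close>, the first is at most \<open>f (\<lambda>_. c) = c\<close> and the second at
  most \<open>f x\<close>.\<close>

lemma sup_homogeneous_if_lower_trunc:
  fixes f :: "('n::finite \<Rightarrow> 'a::bounded_lattice) \<Rightarrow> 'a"
  assumes "mono f"
    and sup: "\<And>x k a b. f (x(k := a \<squnion> b)) = f (x(k := a)) \<squnion> f (x(k := b))"
    and dec: "\<And>x. f x = f (x \<sqinter> (\<lambda>_. c)) \<squnion> f (lower_trunc c x)"
    and idem: "f (\<lambda>_. c) = c"
  shows "f (x \<squnion> (\<lambda>_. c)) = f x \<squnion> c"
proof (rule antisym)
  show "f (x \<squnion> (\<lambda>_. c)) \<le> f x \<squnion> c"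
  proof (rule section_sup_hom_le[OF sup])
    fix z assume z: "\<And>i. z i = x i \<or> z i = c"
    have "f (z \<sqinter> (\<lambda>_. c)) \<le> c"
      using monoD[OF \<open>mono f\<close>, of "z \<sqinter> (\<lambda>_. c)" "\<lambda>_. c"] idem by simp
    \<comment> \<open>Truncation sends every entry \<open>c\<close> of \<open>z\<close> to
      \<bottom>; any surviving entry comes from \<open>x\<close>.\<close>
    moreover have "lower_trunc c z \<le> x"
      unfolding lower_trunc_def le_fun_def by (metis bot_least order_refl z)
    then have "f (lower_trunc c z) \<le> f x"
      by (rule monoD[OF \<open>mono f\<close>])
    ultimately show "f z \<le> f x \<squnion> c"
      using dec[of z] by (simp add: le_supI1 le_supI2)
  qed
  show "f x \<squnion> c \<le> f (x \<squnion> (\<lambda>_. c))"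
    using monoD[OF \<open>mono f\<close>, of x "x \<squnion> (\<lambda>_. c)"] monoD[OF \<open>mono f\<close>, of "\<lambda>_. c" "x \<squnion> (\<lambda>_. c)"] idem
    by simp
qed

text \<open>Order dual: entries \<open>c\<close> are sent to \<top>, so the truncation of a mixed
  tuple lies above \<open>x\<close>.\<close>

lemma inf_homogeneous_if_upper_trunc:
  fixes f :: "('n::finite \<Rightarrow> 'a::bounded_lattice) \<Rightarrow> 'a"
  assumes "mono f"
    and inf: "\<And>x k a b. f (x(k := a \<sqinter> b)) = f (x(k := a)) \<sqinter> f (x(k := b))"
    and dec: "\<And>x. f x = f (x \<squnion> (\<lambda>_. c)) \<sqinter> f (upper_trunc c x)"
    and idem: "f (\<lambda>_. c) = c"
  shows "f (x \<sqinter> (\<lambda>_. c)) = f x \<sqinter> c"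
proof (rule antisym)
  show "f x \<sqinter> c \<le> f (x \<sqinter> (\<lambda>_. c))"
  proof (rule section_inf_hom_ge[OF inf])
    fix z assume z: "\<And>i. z i = x i \<or> z i = c"
    have "c \<le> f (z \<squnion> (\<lambda>_. c))"
      using monoD[OF \<open>mono f\<close>, of "\<lambda>_. c" "z \<squnion> (\<lambda>_. c)"] idem by simp
    moreover have "x \<le> upper_trunc c z"
      unfolding upper_trunc_def le_fun_def by (metis top_greatest order_refl z)
    then have "f x \<le> f (upper_trunc c z)"
      by (rule monoD[OF \<open>mono f\<close>])
    ultimately show "f x \<sqinter> c \<le> f z"
      using dec[of z] by (simp add: le_infI1 le_infI2)
  qed
  show "f (x \<sqinter> (\<lambda>_. c)) \<le> f x \<sqinter> c"
    using monoD[OF \<open>mono f\<close>, of "x \<sqinter> (\<lambda>_. c)" x] monoD[OF \<open>mono f\<close>, of "x \<sqinter> (\<lambda>_. c)" "\<lambda>_. c"] idem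
    by simp
qed

section \<open>Assembly of the equivalences\<close>

theorem mainTheorem1:
  fixes f :: "('n::finite \<Rightarrow> 'a::{distrib_lattice, bounded_lattice}) \<Rightarrow> 'a"
  assumes "mono f"
  shows
    "(lattice_polynomial f \<longleftrightarrow>
        (\<forall>x k. f x = med (f (x(k := \<bottom>))) (x k) (f (x(k := \<top>))))) \<and>
     (lattice_polynomial f \<longleftrightarrow>
        (\<forall>x k a b. f (x(k := a \<sqinter> b)) = f (x(k := a)) \<sqinter> f (x(k := b))) \<and>
        (\<forall>x k a b. f (x(k := a \<squnion> b)) = f (x(k := a)) \<squnion> f (x(k := b))) \<and>
        order_convex (range f) \<and>
        (\<forall>a k. order_convex (range (\<lambda>t. f (a(k := t))))) \<and>
        (\<forall>x k. f (x(k := f x)) = f x)) \<and>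
     (lattice_polynomial f \<longleftrightarrow>
        (\<forall>x. \<forall>c\<in>{f (\<lambda>_. \<bottom>)..f (\<lambda>_. \<top>)}.
           f (x \<sqinter> (\<lambda>_. c)) = f x \<sqinter> c \<and>
           f (x \<squnion> (\<lambda>_. c)) = f x \<squnion> c)) \<and>
     (lattice_polynomial f \<longleftrightarrow>
        (\<forall>x k a b. f (x(k := a \<squnion> b)) = f (x(k := a)) \<squnion> f (x(k := b))) \<and>
        (\<forall>x. \<forall>c\<in>{f (\<lambda>_. \<bottom>)..f (\<lambda>_. \<top>)}.
           f (x \<sqinter> (\<lambda>_. c)) = f x \<sqinter> c \<and>
           f x = f (x \<sqinter> (\<lambda>_. c)) \<squnion> f (lower_trunc c x))) \<and>
     (lattice_polynomial f \<longleftrightarrow>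
        (\<forall>x k a b. f (x(k := a \<sqinter> b)) = f (x(k := a)) \<sqinter> f (x(k := b))) \<and>
        (\<forall>x k a b. f (x(k := a \<squnion> b)) = f (x(k := a)) \<squnion> f (x(k := b))) \<and>
        (\<forall>x. \<forall>c\<in>{f (\<lambda>_. \<bottom>)..f (\<lambda>_. \<top>)}.
           f x = f (x \<sqinter> (\<lambda>_. c)) \<squnion> f (lower_trunc c x) \<and>
           f x = f (x \<squnion> (\<lambda>_. c)) \<sqinter> f (upper_trunc c x)) \<and>
        (\<forall>c\<in>{f (\<lambda>_. \<bottom>)..f (\<lambda>_. \<top>)}. f (\<lambda>_. c) = c))"
  (is "(_ \<longleftrightarrow> ?ii) \<and> (_ \<longleftrightarrow> ?iii) \<and> (_ \<longleftrightarrow> ?iv) \<and> (_ \<longleftrightarrow> ?v) \<and> (_ \<longleftrightarrow> ?vi)")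
proof -
  have ii: ?ii if "lattice_polynomial f"
    using lattice_polynomial_section[OF that] by blast
  have poly: "lattice_polynomial f" if ?ii
    using that by (intro lattice_polynomial_if_section_med) blast
  \<comment> \<open>Homogeneity gives a polynomial through the median condition; (v) and (vi) are
    reduced to homogeneity below.\<close>
  have iv_poly: "lattice_polynomial f" if ?iv
    using that by (intro poly allI section_med_if_homogeneous[OF \<open>mono f\<close>]) auto
  have homogeneous: "f (x \<sqinter> (\<lambda>_. c)) = f x \<sqinter> c" "f (x \<squnion> (\<lambda>_. c)) = f x \<squnion> c"
      "f x = f (x \<sqinter> (\<lambda>_. c)) \<squnion> f (lower_trunc c x)"
      "f x = f (x \<squnion> (\<lambda>_. c)) \<sqinter> f (upper_trunc c x)"
      "f (\<lambda>_. c) = c"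
    if p: "lattice_polynomial f" and "c \<in> {f (\<lambda>_. \<bottom>)..f (\<lambda>_. \<top>)}" for x c
  proof -
    have c: "f (\<lambda>_. \<bottom>) \<le> c" "c \<le> f (\<lambda>_. \<top>)"
      using that by auto
    note hom = lattice_polynomial_homogeneous[OF p c]
    show "f (x \<sqinter> (\<lambda>_. c)) = f x \<sqinter> c" "f (x \<squnion> (\<lambda>_. c)) = f x \<squnion> c"
      by (fact hom)+
    show "f x = f (x \<sqinter> (\<lambda>_. c)) \<squnion> f (lower_trunc c x)"
      by (rule homogeneous_lower_trunc[where x = x and c = c, OF \<open>mono f\<close> hom])
    show "f x = f (x \<squnion> (\<lambda>_. c)) \<sqinter> f (upper_trunc c x)"
      by (rule homogeneous_upper_trunc[where x = x and c = c, OF \<open>mono f\<close> hom(2) hom(1)])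
    show "f (\<lambda>_. c) = c"
      by (rule lattice_polynomial_idem[OF p c])
  qed
  have hom: "f (x(k := a \<sqinter> b)) = f (x(k := a)) \<sqinter> f (x(k := b))"
      "f (x(k := a \<squnion> b)) = f (x(k := a)) \<squnion> f (x(k := b))" if "lattice_polynomial f" for x k a b
    by (rule section_inf_sup_hom[OF \<open>mono f\<close> lattice_polynomial_section[OF that]])+
  have iii: ?iii if p: "lattice_polynomial f"
  proof (intro conjI allI)
    have eq: "f (x(k := y)) = y" if "f (x(k := \<bottom>)) \<le> y" "y \<le> f (x(k := \<top>))" for x k y
      by (rule section_range_eq[OF lattice_polynomial_section[OF p] that])
    show "order_convex (range f)"
      unfolding order_convex_def
    proof clarify
      fix x y c assume "f x \<le> c" "c \<le> f y"
      \<comment> \<open>The constant tuple serves as preimage, since monotonicity puts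
        \<open>c\<close> between the values at the bottom and top tuples.\<close>
      then have "f (\<lambda>_. c) = c"
        using const_bounds(1)[OF \<open>mono f\<close>, of x] const_bounds(2)[OF \<open>mono f\<close>, of y]
        by (intro lattice_polynomial_idem[OF p]) simp_all
      then show "c \<in> range f"
        by (metis rangeI)
    qed
    show "order_convex (range (\<lambda>t. f (a(k := t))))" for a k
      unfolding order_convex_def
    proof clarify
      fix s t c assume "f (a(k := s)) \<le> c" "c \<le> f (a(k := t))"
      then have "f (a(k := c)) = c"
        using section_bounds(1)[OF \<open>mono f\<close>, of a k s] section_bounds(2)[OF \<open>mono f\<close>, of a k t]
        by (intro eq) simp_all
      then show "c \<in> range (\<lambda>t. f (a(k := t)))"
        by (metis rangeI)
    qed
    show "f (x(k := f x)) = f x" for x k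
      using section_bounds[OF \<open>mono f\<close>, of x k "x k"] by (intro eq) simp_all
  qed (simp_all add: hom[OF p])
  have iii_poly: "lattice_polynomial f" if ?iii
    using that by (intro poly allI section_med_if_hom_convex[OF \<open>mono f\<close>]) blast+
  have v_poly: "lattice_polynomial f" if ?v
  proof (rule iv_poly, intro allI ballI conjI)
    fix x c assume c: "c \<in> {f (\<lambda>_. \<bottom>)..f (\<lambda>_. \<top>)}"
    show inf: "f (x \<sqinter> (\<lambda>_. c)) = f x \<sqinter> c" for x
      using that c by blast
    \<comment> \<open>Condition (v) does not state idempotence; it is homogeneity for meets at the
      top tuple, using \<open>c \<le> f (\<lambda>_. \<top>)\<close>.\<close>
    have "f (\<lambda>_. c) = c"
      using inf[of "\<lambda>_. \<top>"] c by (simp add: inf_fun_def inf.absorb2)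
    then show "f (x \<squnion> (\<lambda>_. c)) = f x \<squnion> c"
      using that c by (intro sup_homogeneous_if_lower_trunc[OF \<open>mono f\<close>]) blast+
  qed
  have vi_poly: "lattice_polynomial f" if ?vi
  proof (rule iv_poly, intro allI ballI conjI)
    fix x c assume c: "c \<in> {f (\<lambda>_. \<bottom>)..f (\<lambda>_. \<top>)}"
    show "f (x \<sqinter> (\<lambda>_. c)) = f x \<sqinter> c"
      using that c by (intro inf_homogeneous_if_upper_trunc[OF \<open>mono f\<close>]) blast+
    show "f (x \<squnion> (\<lambda>_. c)) = f x \<squnion> c"
      using that c by (intro sup_homogeneous_if_lower_trunc[OF \<open>mono f\<close>]) blast+
  qed
  have iv: ?iv if "lattice_polynomial f"
    using homogeneous(1,2)[OF that] by blast
  have v: ?v if "lattice_polynomial f"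
    using hom(2)[OF that] homogeneous(1,3)[OF that] by blast
  have vi: ?vi if "lattice_polynomial f"
    using hom[OF that] homogeneous(3-5)[OF that] by blast
  from iffI[OF ii poly] iffI[OF iii iii_poly] iffI[OF iv iv_poly] iffI[OF v v_poly] iffI[OF vi vi_poly]
  show ?thesis
    by (intro conjI)
qed

end
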